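(* Let $q$ be a prime power and let $k,n$ be positive integers such that $k\mid n$. Put $N=\frac{q^n-1}{q^k-1}$, let $\omega$ be a primitive element of $\mathbb{F}_{q^n}$, and for $i=0,1,\dots,N-1$ let $V_i=\omega^i\mathbb{F}_{q^k}=\{\omega^i x: x\in\mathbb{F}_{q^k}\}\subseteq\mathbb{F}_{q^n}$. For $0\le i,j\le N-1$ let $$S_{ij}=\{M\in \mathrm{GL}(n,q): M(V_i)=V_j\}.$$ Then $$P(n,k,q)\ \ge\ \frac{|\mathrm{GL}(n,q)|}{\left|\bigcup_{i,j=0}^{N-1}S_{ij}\right|}.$$
   Context: $V(n,q)$ denotes an $n$-dimensional vector space over the finite field $\mathbb{F}_q$; it is identified with $\mathbb{F}_{q^n}$ regarded as an $\mathbb{F}_q$-vector space, and $\mathrm{GL}(n,q)$ is the group of invertible $\mathbb{F}_q$-linear maps of it. A $k$-spread of $V(n,q)$ is a set of $k$-dimensional $\mathbb{F}_q$-subspaces of $V(n,q)$ such that every nonzero vector lies in exactly one of them. A partial $k$-parallelism of $V(n,q)$ is a collection of $k$-spreads of $V(n,q)$ that are pairwise disjoint as sets of subspaces (no $k$-dimensional subspace belongs to two of the spreads). $P(n,k,q)$ denotes the maximum size (number of spreads) of a partial $k$-parallelism of $V(n,q)$. *)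

theory Defs
  imports Complex_Main "HOL-Library.Cardinality" "HOL-Number_Theory.Prime_Powers"
begin

definition field_embedding :: "('f::field \<Rightarrow> 'a::field) \<Rightarrow> bool" where
  "field_embedding \<iota> \<longleftrightarrow>
     \<iota> 1 = 1 \<and> (\<forall>a b. \<iota> (a + b) = \<iota> a + \<iota> b) \<and> (\<forall>a b. \<iota> (a * b) = \<iota> a * \<iota> b)"

definition extension_scale :: "('f::field \<Rightarrow> 'a::field) \<Rightarrow> 'f \<Rightarrow> 'a \<Rightarrow> 'a" where
  "extension_scale \<iota> = (\<lambda>c x. \<iota> c * x)"

lemma vector_space_extension_scale:
  assumes "field_embedding \<iota>"
  shows "vector_space (extension_scale \<iota>)"
  using assms unfolding field_embedding_def extension_scale_def
  by unfold_locales (auto simp: algebra_simps)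

definition is_subfield :: "'a::field set \<Rightarrow> bool" where
  "is_subfield L \<longleftrightarrow> 0 \<in> L \<and> 1 \<in> L \<and>
     (\<forall>x\<in>L. \<forall>y\<in>L. x - y \<in> L \<and> x * y \<in> L) \<and> (\<forall>x\<in>L. inverse x \<in> L)"

definition primitive_element :: "'a::field \<Rightarrow> bool" where
  "primitive_element \<omega> \<longleftrightarrow> range (\<lambda>m::nat. \<omega> ^ m) = UNIV - {0}"

definition spread :: "('f::field \<Rightarrow> 'v::ab_group_add \<Rightarrow> 'v) \<Rightarrow> nat \<Rightarrow> 'v set set \<Rightarrow> bool" where
  "spread scale k S \<longleftrightarrow>
     (\<forall>U\<in>S. module.subspace scale U \<and> vector_space.dim scale U = k) \<and>
     (\<forall>v. v \<noteq> 0 \<longrightarrow> (\<exists>!U. U \<in> S \<and> v \<in> U))"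

definition partial_parallelism ::
  "('f::field \<Rightarrow> 'v::ab_group_add \<Rightarrow> 'v) \<Rightarrow> nat \<Rightarrow> 'v set set set \<Rightarrow> bool" where
  "partial_parallelism scale k P \<longleftrightarrow> (\<forall>S\<in>P. spread scale k S) \<and> pairwise disjnt P"

text \<open>The vector space is required to be finite, so that the maximum is over a finite set.\<close>
definition max_partial_parallelism ::
  "('f::field \<Rightarrow> 'v::{ab_group_add,finite} \<Rightarrow> 'v) \<Rightarrow> nat \<Rightarrow> nat" where
  "max_partial_parallelism scale k = Max {card P |P. partial_parallelism scale k P}"

definition general_linear :: "('f::field \<Rightarrow> 'v::ab_group_add \<Rightarrow> 'v) \<Rightarrow> ('v \<Rightarrow> 'v) set" where
  "general_linear scale = {M. Vector_Spaces.linear scale scale M \<and> bij M}"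

end

theory Submission
  imports Defs "HOL-Computational_Algebra.Polynomial"
begin

text \<open>Let \<open>F\<close> be the spread consisting of the \<open>V\<^sub>i\<close>. For \<open>x\<close> and \<open>y\<close> in the general linear group,
  the spreads \<open>x F\<close> and \<open>y F\<close> share a subspace exactly when \<open>x\<^sup>-\<^sup>1 y\<close> lies in the union of the
  \<open>S\<^sub>i\<^sub>j\<close>. In a maximal family of group elements whose images of \<open>F\<close> are pairwise disjoint, the
  translates of that union by members of the family therefore cover the group. The \<open>V\<^sub>i\<close> form a
  spread because the subfield of order \<open>q ^ k\<close> is the whole solution set of \<open>x ^ q ^ k = x\<close>.\<close>

section \<open>Spreads and linear bijections\<close>

text \<open>Each new basis vector \<open>a\<close> multiplies the count by \<open>CARD('a)\<close>,
  since a vector of the larger span determines its coefficient at \<open>a\<close> and its remainder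
  in \<open>span B\<close>.\<close>

lemma (in vector_space) card_span_independent:
  assumes "finite B" "independent B"
  shows "card (span B) = CARD('a) ^ card B"
  using assms
proof (induction B rule: finite_induct)
  case empty
  then show ?case by simp
next
  case (insert a B)
  have ind: "independent B" and a: "a \<notin> span B"
    using insert by (auto simp: independent_insert)
  let ?f = "\<lambda>(c, y). c *s a + y"
  have "inj_on ?f (UNIV \<times> span B)"
  proof (rule inj_onI, clarify)
    fix c y d z
    assume y: "y \<in> span B" and z: "z \<in> span B" and eq: "c *s a + y = d *s a + z"
    have "(c - d) *s a = z - y"
      using eq by (simp add: scale_left_diff_distrib algebra_simps)
    then have "(c - d) *s a \<in> span B"
      using y z by (simp add: span_diff)
    \<comment> \<open>Otherwise scaling by the inverse of \<open>c - d\<close> would put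
      \<open>a\<close> into \<open>span B\<close>.\<close>
    then have "c = d"
      using a span_scale[of "(c - d) *s a" B "inverse (c - d)"] by (cases "c = d") auto
    then show "c = d \<and> y = z" using eq by simp
  qed
  moreover have "?f ` (UNIV \<times> span B) = span (insert a B)"
  proof (intro equalityI subsetI)
    fix x assume "x \<in> span (insert a B)"
    then obtain c where "x - c *s a \<in> span B" by (auto simp: span_insert)
    then show "x \<in> ?f ` (UNIV \<times> span B)"
      by (intro image_eqI[of _ _ "(c, x - c *s a)"]) simp_all
  next
    fix x assume "x \<in> ?f ` (UNIV \<times> span B)"
    then obtain c y where "x = c *s a + y" "y \<in> span B" by auto
    then show "x \<in> span (insert a B)"
      unfolding span_breakdown_eq by (intro exI[of _ c]) simp
  qed
  ultimately have "card (span (insert a B)) = card ((UNIV :: 'a set) \<times> span B)"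
    by (metis card_image)
  then show ?case using insert ind by (simp add: card_cartesian_product)
qed

text \<open>Serves below to read off the dimension of a coset of the subfield from its size.\<close>

lemma (in vector_space) card_subspace:
  assumes "subspace U" "finite U"
  shows "card U = CARD('a) ^ dim U"
proof -
  obtain B where B: "B \<subseteq> U" "independent B" "U \<subseteq> span B" "card B = dim U"
    using basis_exists[of U] by blast
  then have "span B = U" using assms(1) by (simp add: span_subspace)
  then show ?thesis
    using card_span_independent[of B] B assms(2) finite_subset by metis
qed

lemma (in vector_space) dim_inj_image:
  assumes "Vector_Spaces.linear scale scale f" "inj f"
  shows "dim (f ` U) = dim U"
proof -
  interpret vector_space_pair scale scale by unfold_locales
  obtain B where B: "B \<subseteq> U" "independent B" "U \<subseteq> span B" "card B = dim U"
    using basis_exists[of U] by blast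
  have "span B = span U"
    using B by (metis span_eq span_superset subset_trans)
  then have "span (f ` B) = span (f ` U)"
    using assms(1) linear_span_image by metis
  moreover have "independent (f ` B)"
    using B(2) assms linear_independent_injective_image inj_on_subset by blast
  ultimately have "dim (f ` U) = card (f ` B)" by (intro dim_eq_card)
  also have "\<dots> = card B" using assms(2) by (simp add: card_image inj_on_subset)
  finally show ?thesis using B by simp
qed

lemma comp_in_general_linear:
  "f \<in> general_linear scale \<Longrightarrow> g \<in> general_linear scale \<Longrightarrow> g \<circ> f \<in> general_linear scale"
  by (auto simp: general_linear_def intro: Vector_Spaces.linear_compose bij_comp)

lemma inv_in_general_linear:
  assumes "f \<in> general_linear scale"
  shows "inv f \<in> general_linear scale"
proof -
  have lin: "Vector_Spaces.linear scale scale f" and bij: "bij f"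
    using assms by (auto simp: general_linear_def)
  interpret Vector_Spaces.linear scale scale f by (rule lin)
  have "inv f (x + y) = inv f x + inv f y" for x y
    using bij by (intro inv_f_eq) (auto simp: add bij_def surj_f_inv_f)
  moreover have "inv f (scale c x) = scale c (inv f x)" for c x
    using bij by (intro inv_f_eq) (auto simp: scale bij_def surj_f_inv_f)
  ultimately have "Vector_Spaces.linear scale scale (inv f)"
    by (simp add: Vector_Spaces.linear_iff vs1.vector_space_axioms)
  then show ?thesis using bij by (simp add: general_linear_def bij_imp_bij_inv)
qed

text \<open>A nonzero \<open>v\<close> has a nonzero preimage \<open>u\<close>, and by injectivity
  the images containing \<open>v\<close> are those of the members containing
  \<open>u\<close>.\<close>

lemma (in vector_space) spread_image:
  assumes "M \<in> general_linear scale" "spread scale k F"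
  shows "spread scale k ((`) M ` F)"
proof -
  interpret vector_space_pair scale scale by unfold_locales
  have lin: "Vector_Spaces.linear scale scale M" and bij: "bij M"
    using assms(1) by (auto simp: general_linear_def)
  then have inj: "inj M" by (simp add: bij_is_inj)
  have "subspace (M ` U) \<and> dim (M ` U) = k" if "U \<in> F" for U
  proof -
    have "subspace U" "dim U = k" using assms(2) that by (simp_all add: spread_def)
    then show ?thesis
      using linear_subspace_image[OF lin] dim_inj_image[OF lin inj] by simp
  qed
  moreover have "\<exists>!W. W \<in> (`) M ` F \<and> v \<in> W" if "v \<noteq> 0" for v
  proof -
    obtain u where u: "v = M u" using bij by (metis bij_pointE)
    then have "u \<noteq> 0" using that linear_0[OF lin] by blast
    then have ex1: "\<exists>!U. U \<in> F \<and> u \<in> U" using assms(2) unfolding spread_def by blast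
    then obtain U where U: "U \<in> F" "u \<in> U" by blast
    show ?thesis
    proof (intro ex1I[of _ "M ` U"] conjI)
      fix W assume W: "W \<in> (`) M ` F \<and> v \<in> W"
      then obtain U' where U': "U' \<in> F" "W = M ` U'" by (elim conjE imageE)
      then have "u \<in> U'" using W u inj by (simp add: inj_image_mem_iff)
      then show "W = M ` U" using ex1 U U' by blast
    qed (use U u in simp_all)
  qed
  ultimately show ?thesis unfolding spread_def by blast
qed

section \<open>The greedy bound\<close>

text \<open>Read \<open>R\<close> as adjacency in a graph with loops. The neighbourhoods of a
  maximal independent set cover \<open>G\<close>, since an uncovered vertex could be added to it;
  each has at most \<open>d\<close> elements.\<close>

lemma greedy_independent_set:
  assumes "finite G"
    and "\<And>x. x \<in> G \<Longrightarrow> R x x"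
    and "\<And>x y. x \<in> G \<Longrightarrow> y \<in> G \<Longrightarrow> R x y \<Longrightarrow> R y x"
    and "\<And>x. x \<in> G \<Longrightarrow> card {y \<in> G. R x y} \<le> d"
  obtains X where "X \<subseteq> G" "pairwise (\<lambda>x y. \<not> R x y) X" "card G \<le> card X * d"
proof -
  let ?I = "{X. X \<subseteq> G \<and> pairwise (\<lambda>x y. \<not> R x y) X}"
  have "finite ?I" using assms(1) by simp
  moreover have "?I \<noteq> {}" by (rule ex_in_conv[THEN iffD1], rule exI[of _ "{}"]) simp
  ultimately obtain X where X: "X \<in> ?I" and max: "\<forall>Y\<in>?I. X \<subseteq> Y \<longrightarrow> X = Y"
    by (rule finite_has_maximal[THEN bexE])
  have "G \<subseteq> (\<Union>x\<in>X. {y \<in> G. R x y})"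
  proof
    fix y assume y: "y \<in> G"
    show "y \<in> (\<Union>x\<in>X. {y \<in> G. R x y})"
    proof (rule ccontr)
      assume n: "y \<notin> (\<Union>x\<in>X. {y \<in> G. R x y})"
      then have "insert y X \<in> ?I"
        using X y assms(3) by (auto simp: pairwise_insert)
      then have "y \<in> X" using max by (metis insertI1 subset_insertI)
      then show False using n y assms(2) by auto
    qed
  qed
  then have "card G \<le> card (\<Union>x\<in>X. {y \<in> G. R x y})"
    using X assms(1) by (intro card_mono) (auto intro: finite_subset)
  also have "\<dots> \<le> (\<Sum>x\<in>X. card {y \<in> G. R x y})"
    using X assms(1) by (intro card_UN_le) (auto intro: finite_subset)
  also have "\<dots> \<le> card X * d"
    using X assms(4) sum_bounded_above[of X "\<lambda>x. card {y \<in> G. R x y}" d] by auto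
  finally show thesis using X that by blast
qed

text \<open>Over a finite vector space there are only finitely many families of sets of subspaces,
  so \<open>Max\<close> is a genuine upper bound.\<close>

lemma card_le_max_partial_parallelism:
  "partial_parallelism scale k P \<Longrightarrow> card P \<le> max_partial_parallelism scale k"
  unfolding max_partial_parallelism_def by (intro Max_ge) auto

text \<open>The set on the right is the neighbourhood of the identity in the relation
  \<open>?R\<close> of having images of \<open>F\<close> with a common member. Left multiplication
  by \<open>inv x\<close> embeds the neighbourhood of \<open>x\<close> into it, which gives the
  uniform degree bound.\<close>

lemma card_general_linear_le:
  fixes scale :: "'f::field \<Rightarrow> 'v::{ab_group_add,finite} \<Rightarrow> 'v"
  assumes vs: "vector_space scale" and F: "spread scale k F" "F \<noteq> {}"
  shows "card (general_linear scale) \<le> max_partial_parallelism scale k *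
    card {M \<in> general_linear scale. \<not> disjnt ((`) M ` F) F}"
proof -
  let ?G = "general_linear scale"
  let ?D = "{M \<in> ?G. \<not> disjnt ((`) M ` F) F}"
  let ?R = "\<lambda>x y. \<not> disjnt ((`) x ` F) ((`) y ` F)"
  have bound: "card {y \<in> ?G. ?R x y} \<le> card ?D" if x: "x \<in> ?G" for x
  proof (rule card_inj_on_le)
    have bij: "bij x" using x by (simp add: general_linear_def)
    show "inj_on (\<lambda>y. inv x \<circ> y) {y \<in> ?G. ?R x y}"
      using bij by (intro inj_on_inverseI[where g = "\<lambda>z. x \<circ> z"])
        (simp add: fun_eq_iff bij_is_surj surj_f_inv_f)
    show "(\<lambda>y. inv x \<circ> y) ` {y \<in> ?G. ?R x y} \<subseteq> ?D"
    proof clarify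
      fix y assume y: "y \<in> ?G" and "?R x y"
      then obtain U W where "U \<in> F" "W \<in> F" "x ` U = y ` W"
        by (auto simp: disjnt_iff)
      then have "(inv x \<circ> y) ` W = U"
        using bij by (metis bij_is_inj image_comp image_inv_f_f)
      then have "U \<in> (`) (inv x \<circ> y) ` F"
        using \<open>W \<in> F\<close> by (rule image_eqI[OF sym])
      then have "\<not> disjnt ((`) (inv x \<circ> y) ` F) F"
        unfolding disjnt_iff using \<open>U \<in> F\<close> by blast
      then show "inv x \<circ> y \<in> ?G \<and> \<not> disjnt ((`) (inv x \<circ> y) ` F) F"
        using x y by (simp add: comp_in_general_linear inv_in_general_linear)
    qed
  qed auto
  obtain X where X: "X \<subseteq> ?G" "pairwise (\<lambda>x y. \<not> ?R x y) X" "card ?G \<le> card X * card ?D"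
  proof (rule greedy_independent_set[of ?G ?R "card ?D"])
    show "?R x x" for x using F(2) by simp
    show "?R y x" if "?R x y" for x y using that disjnt_sym by blast
  qed (use bound in simp_all)
  let ?P = "(\<lambda>x. (`) x ` F) ` X"
  \<comment> \<open>Distinct elements of \<open>X\<close> have disjoint images of \<open>F\<close>;
    as \<open>F\<close> is nonempty, these images differ, so no spread is counted twice.\<close>
  have "inj_on (\<lambda>x. (`) x ` F) X"
  proof (rule inj_onI, rule ccontr)
    fix x y assume "x \<in> X" "y \<in> X" "(`) x ` F = (`) y ` F" "x \<noteq> y"
    then have "disjnt ((`) x ` F) ((`) x ` F)" using pairwiseD[OF X(2)] by fastforce
    then show False using F(2) by simp
  qed
  then have card_X: "card ?P = card X" by (simp add: card_image)
  have "partial_parallelism scale k ?P"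
    unfolding partial_parallelism_def
  proof (intro conjI ballI pairwiseI)
    fix A assume "A \<in> ?P"
    then show "spread scale k A" using X(1) vector_space.spread_image[OF vs _ F(1)] by blast
  next
    fix A B assume "A \<in> ?P" "B \<in> ?P" "A \<noteq> B"
    then show "disjnt A B" using pairwiseD[OF X(2)] by blast
  qed
  then have "card ?P \<le> max_partial_parallelism scale k"
    by (rule card_le_max_partial_parallelism)
  then show ?thesis
    using X(3) unfolding card_X by (meson le_trans mult_le_mono1)
qed

section \<open>The cosets of a subfield form a spread\<close>

text \<open>Multiplication by a nonzero \<open>x\<close> permutes the nonzero elements of
  \<open>L\<close>; comparing their products gives \<open>x ^ (card L - 1) = 1\<close>.\<close>

lemma subfield_power_card_eq:
  assumes L: "is_subfield L" and fin: "finite L" and x: "x \<in> L"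
  shows "x ^ card L = x"
proof (cases "x = 0")
  case True
  \<comment> \<open>Because \<open>0 ^ 0 = 1\<close>, this case depends on \<open>card L\<close>
    being positive.\<close>
  then show ?thesis using x fin by (auto simp: card_gt_0_iff)
next
  case False
  have mult: "a * b \<in> L" if "a \<in> L" "b \<in> L" for a b
    using L that by (simp add: is_subfield_def)
  have inv: "inverse a \<in> L" if "a \<in> L" for a
    using L that by (simp add: is_subfield_def)
  have "(*) x ` (L - {0}) = L - {0}"
  proof (intro equalityI subsetI)
    fix y assume "y \<in> L - {0}"
    then show "y \<in> (*) x ` (L - {0})"
      using x False by (intro image_eqI[of _ _ "inverse x * y"]) (auto intro: mult inv)
  qed (use x False in \<open>auto intro: mult\<close>)
  then have "\<Prod>(L - {0}) = (\<Prod>y\<in>L - {0}. x * y)"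
    using False prod.reindex[of "(*) x" "L - {0}" "\<lambda>y. y"] by (simp add: inj_on_def)
  also have "\<dots> = x ^ card (L - {0}) * \<Prod>(L - {0})"
    by (simp add: prod.distrib)
  finally have "x ^ card (L - {0}) = 1"
    using fin by simp
  moreover have "card L = Suc (card (L - {0}))"
    using L fin by (intro card.remove) (auto simp: is_subfield_def)
  ultimately show ?thesis by simp
qed

text \<open>All elements of \<open>L\<close> are roots of \<open>X ^ card L - X\<close>, which has
  at most \<open>card L\<close> roots. Membership in \<open>L\<close> thus becomes a test by a power
  equation.\<close>

lemma subfield_eq_roots:
  fixes L :: "'a::field set"
  assumes L: "is_subfield L" and fin: "finite L"
  shows "L = {x. x ^ card L = x}"
proof -
  let ?m = "card L"
  let ?p = "monom (1 :: 'a) ?m - monom 1 1"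
  have "{0, 1} \<subseteq> L" using L by (auto simp: is_subfield_def)
  \<comment> \<open>With exponent 1 the two monomials would cancel and the root bound would be
    lost.\<close>
  then have m: "2 \<le> ?m" using card_mono[OF fin, of "{0, 1}"] by simp
  then have "coeff ?p ?m \<noteq> 0" by simp
  then have p: "?p \<noteq> 0" by (metis coeff_0)
  have roots: "{x. poly ?p x = 0} = {x. x ^ ?m = x}"
    by (auto simp: poly_monom)
  have "card {x :: 'a. x ^ ?m = x} \<le> degree ?p"
    using card_poly_roots_bound[OF p] by (simp only: roots)
  also have "\<dots> \<le> ?m"
    using m by (intro degree_diff_le) (auto simp: degree_monom_eq)
  finally show ?thesis
    using subfield_power_card_eq[OF assms] poly_roots_finite[OF p]
    unfolding roots by (intro card_seteq) auto
qed

lemma field_embedding_power: "field_embedding \<iota> \<Longrightarrow> \<iota> (x ^ m) = \<iota> x ^ m"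
  by (induction m) (auto simp: field_embedding_def)

text \<open>Iterating \<open>c ^ CARD('f) = c\<close> gives \<open>c ^ card L = c\<close>, and the
  embedding carries this over to the equation that characterises \<open>L\<close>. This makes cosets
  of \<open>L\<close> closed under the scalars.\<close>

lemma embedding_in_subfield:
  fixes \<iota> :: "'f::{field,finite} \<Rightarrow> 'a::field"
  assumes \<iota>: "field_embedding \<iota>" and L: "is_subfield L" "finite L" "card L = CARD('f) ^ k"
  shows "\<iota> c \<in> L"
proof -
  have "is_subfield (UNIV :: 'f set)" by (simp add: is_subfield_def)
  then have c: "c ^ CARD('f) = c" by (intro subfield_power_card_eq) auto
  have "c ^ CARD('f) ^ k = c" by (induction k) (simp_all add: c power_mult)
  then have "\<iota> c ^ card L = \<iota> c"
    using \<iota> L(3) by (metis field_embedding_power)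
  then show ?thesis using subfield_eq_roots[OF L(1,2)] by blast
qed

lemma minus_one_dvd_power_minus_one: "(b::nat) - 1 dvd b ^ m - 1"
proof (cases "b = 0")
  case False
  \<comment> \<open>The geometric sum factorisation is applied over the integers, where subtraction
    is not truncated.\<close>
  then have "int (b - 1) dvd int (b ^ m - 1)"
    by (simp add: of_nat_diff power_diff_1_eq)
  then show ?thesis by (simp only: of_nat_dvd_iff)
\<comment> \<open>For \<open>b = 0\<close> truncated subtraction makes both sides 0.\<close>
qed (cases m; simp)

text \<open>Here \<open>v = a * y\<close> with \<open>y\<close> a nonzero element of
  \<open>L\<close>, and multiplication by \<open>y\<close> permutes \<open>L\<close>. Hence cosets
  sharing a nonzero vector coincide.\<close>

lemma coset_eq_of_mem:
  assumes "is_subfield L" "a \<noteq> 0" "v \<noteq> 0" "v \<in> (*) a ` L"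
  shows "(*) a ` L = (*) v ` L"
proof -
  obtain y where y: "y \<in> L" "v = a * y" using assms(4) by blast
  then have "y \<noteq> 0" and inv: "inverse y \<in> L" using assms by (auto simp: is_subfield_def)
  have mult: "x * z \<in> L" if "x \<in> L" "z \<in> L" for x z
    using assms(1) that by (simp add: is_subfield_def)
  show ?thesis
  proof (intro equalityI subsetI)
    fix w assume "w \<in> (*) a ` L"
    then obtain x where "x \<in> L" "w = a * x" by blast
    then show "w \<in> (*) v ` L"
      using y inv mult \<open>y \<noteq> 0\<close> by (intro image_eqI[of _ _ "inverse y * x"]) simp_all
  next
    fix w assume "w \<in> (*) v ` L"
    then obtain x where "x \<in> L" "w = v * x" by blast
    then show "w \<in> (*) a ` L"
      using y mult by (intro image_eqI[of _ _ "y * x"]) simp_all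
  qed
qed

text \<open>Dimensions come from counting, covering from reducing exponents of
  \<open>\<omega>\<close> modulo \<open>N\<close>, and uniqueness from
  \<open>coset_eq_of_mem\<close>.\<close>

lemma desarguesian_spread:
  fixes \<iota> :: "'f::{field,finite} \<Rightarrow> 'a::{field,finite}"
  assumes \<iota>: "field_embedding \<iota>" and L: "is_subfield L" "card L = CARD('f) ^ k"
    and \<omega>: "primitive_element \<omega>"
    and N: "N = (CARD('a) - 1) div (card L - 1)" and dvd: "card L - 1 dvd CARD('a) - 1"
  shows "N > 0" and "spread (extension_scale \<iota>) k ((\<lambda>i. (*) (\<omega> ^ i) ` L) ` {..<N})"
proof -
  interpret vector_space "extension_scale \<iota>"
    by (rule vector_space_extension_scale[OF \<iota>])
  have zero: "0 \<in> L" and one: "1 \<in> L"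
    and mult: "\<And>x y. x \<in> L \<Longrightarrow> y \<in> L \<Longrightarrow> x * y \<in> L"
    and diff: "\<And>x y. x \<in> L \<Longrightarrow> y \<in> L \<Longrightarrow> x - y \<in> L"
    using L(1) by (auto simp: is_subfield_def)
  have add: "x + y \<in> L" if "x \<in> L" "y \<in> L" for x y
    using diff[of x "0 - y"] diff[of 0 y] that zero by simp
  have \<omega>0: "\<omega> \<noteq> 0"
    using \<omega> power_one_right[of \<omega>] unfolding primitive_element_def by (metis Diff_iff rangeI singletonI)
  have card_L: "2 \<le> card L"
    using card_mono[of L "{0, 1}"] zero one by simp
  have card_f: "2 \<le> CARD('f)"
    using card_mono[of "UNIV :: 'f set" "{0, 1}"] by simp
  have card_a: "card L \<le> CARD('a)" by (simp add: card_mono)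
  then show N0: "N > 0"
    using N card_L by (simp add: div_greater_zero_iff)
  have mN: "CARD('a) - 1 = N * (card L - 1)" using dvd N by simp
  \<comment> \<open>Since \<open>N * (card L - 1) = CARD('a) - 1\<close>, the power
    \<open>\<omega> ^ N\<close> satisfies the equation whose roots form \<open>L\<close>.\<close>
  have \<omega>N: "\<omega> ^ N \<in> L"
  proof -
    have "is_subfield (UNIV :: 'a set)" by (simp add: is_subfield_def)
    then have "\<omega> ^ CARD('a) = \<omega>" by (intro subfield_power_card_eq) auto
    then have "\<omega> * \<omega> ^ (CARD('a) - 1) = \<omega>"
      using zero_less_card_finite by (metis power_eq_if less_not_refl)
    then have "(\<omega> ^ N) ^ (card L - 1) = 1" using \<omega>0 mN by (simp add: power_mult)
    then have "(\<omega> ^ N) ^ card L = \<omega> ^ N"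
      using card_L power_eq_if[of "\<omega> ^ N" "card L"] by (simp split: if_splits)
    then show ?thesis using subfield_eq_roots[OF L(1) finite] by blast
  qed
  have \<omega>Nm: "(\<omega> ^ N) ^ m \<in> L" for m
    by (induction m) (auto simp: one \<omega>N mult)
  have "subspace ((*) a ` L) \<and> dim ((*) a ` L) = k" if "a \<noteq> 0" for a
  proof -
    have sub: "subspace ((*) a ` L)"
    proof (rule subspaceI)
      show "0 \<in> (*) a ` L" using zero by force
      show "x + y \<in> (*) a ` L" if "x \<in> (*) a ` L" "y \<in> (*) a ` L" for x y
        using that by (auto simp: image_iff simp flip: distrib_left intro: add)
      show "extension_scale \<iota> c x \<in> (*) a ` L" if "x \<in> (*) a ` L" for c x
      proof -
        obtain y where "y \<in> L" "x = a * y" using \<open>x \<in> (*) a ` L\<close> by blast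
        then show ?thesis
          using embedding_in_subfield[OF \<iota> L(1) _ L(2), of c] mult
          by (intro image_eqI[of _ _ "\<iota> c * y"]) (auto simp: extension_scale_def)
      qed
    qed
    \<comment> \<open>The coset has as many elements as \<open>L\<close>, and
      \<open>CARD('f)\<close> is at least 2, so comparing powers of it determines the
      dimension.\<close>
    have "CARD('f) ^ dim ((*) a ` L) = card ((*) a ` L)"
      using card_subspace[OF sub] by simp
    also have "\<dots> = CARD('f) ^ k"
      using that L(2) by (simp add: card_image inj_on_def)
    finally show ?thesis using sub card_f by (simp add: power_inject_exp)
  qed
  moreover have "\<exists>!U. U \<in> (\<lambda>i. (*) (\<omega> ^ i) ` L) ` {..<N} \<and> v \<in> U" if v: "v \<noteq> 0" for v
  proof (rule ex_ex1I)
    obtain m where m: "v = \<omega> ^ m"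
      using \<omega> v unfolding primitive_element_def by blast
    \<comment> \<open>The factor \<open>(\<omega> ^ N) ^ (m div N)\<close> lies in \<open>L\<close>,
      so \<open>v\<close> belongs to the coset with index \<open>m mod N\<close>.\<close>
    then have "v = \<omega> ^ (m mod N) * (\<omega> ^ N) ^ (m div N)"
      by (metis mod_mult_div_eq power_add power_mult)
    then have "v \<in> (*) (\<omega> ^ (m mod N)) ` L" using \<omega>Nm by blast
    then show "\<exists>U. U \<in> (\<lambda>i. (*) (\<omega> ^ i) ` L) ` {..<N} \<and> v \<in> U"
      using N0 by (intro exI[of _ "(*) (\<omega> ^ (m mod N)) ` L"]) auto
  next
    fix U W
    assume "U \<in> (\<lambda>i. (*) (\<omega> ^ i) ` L) ` {..<N} \<and> v \<in> U"
      and "W \<in> (\<lambda>i. (*) (\<omega> ^ i) ` L) ` {..<N} \<and> v \<in> W"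
    then obtain i j where "U = (*) (\<omega> ^ i) ` L" "v \<in> U" "W = (*) (\<omega> ^ j) ` L" "v \<in> W" by blast
    then show "U = W" using coset_eq_of_mem[OF L(1) _ v] \<omega>0 by (metis power_not_zero)
  qed
  ultimately show "spread (extension_scale \<iota>) k ((\<lambda>i. (*) (\<omega> ^ i) ` L) ` {..<N})"
    using \<omega>0 by (auto simp: spread_def)
qed

theorem theorem3p1:
  fixes q n k N :: nat
    and \<iota> :: "'f::{field,finite} \<Rightarrow> 'a::{field,finite}"
    and L :: "'a set" and \<omega> :: 'a
    and V :: "nat \<Rightarrow> 'a set" and S :: "nat \<Rightarrow> nat \<Rightarrow> ('a \<Rightarrow> 'a) set"
  assumes "primepow q" and "k > 0" and "n > 0" and "k dvd n"
    and "CARD('f) = q" and "CARD('a) = q ^ n" and "field_embedding \<iota>"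
    and "is_subfield L" and "card L = q ^ k"
    and "primitive_element \<omega>"
    and "N = (q ^ n - 1) div (q ^ k - 1)"
    and "\<And>i. i < N \<Longrightarrow> V i = {\<omega> ^ i * x |x. x \<in> L}"
    and "\<And>i j. i < N \<Longrightarrow> j < N \<Longrightarrow>
           S i j = {M \<in> general_linear (extension_scale \<iota>). M ` V i = V j}"
  shows "real (max_partial_parallelism (extension_scale \<iota>) k)
         \<ge> real (card (general_linear (extension_scale \<iota>)))
            / real (card (\<Union>i<N. \<Union>j<N. S i j))"
proof -
  let ?G = "general_linear (extension_scale \<iota>)"
  let ?D = "\<Union>i<N. \<Union>j<N. S i j"
  let ?F = "V ` {..<N}"
  obtain m where "n = k * m" using \<open>k dvd n\<close> by (elim dvdE)
  then have dvd: "q ^ k - 1 dvd q ^ n - 1"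
    using minus_one_dvd_power_minus_one[of "q ^ k" m] by (simp add: power_mult)
  have F: "?F = (\<lambda>i. (*) (\<omega> ^ i) ` L) ` {..<N}"
    using assms(12) by (intro image_cong) auto
  have N: "N > 0" and spread: "spread (extension_scale \<iota>) k ?F"
    unfolding F using desarguesian_spread[of \<iota> L k \<omega> N] dvd assms(5-11) by simp_all
  have "?D = {M \<in> ?G. \<not> disjnt ((`) M ` ?F) ?F}"
  proof (intro equalityI subsetI)
    fix M assume "M \<in> ?D"
    then obtain i j where "i < N" "j < N" "M \<in> ?G" "M ` V i = V j"
      using assms(13) by auto
    then show "M \<in> {M \<in> ?G. \<not> disjnt ((`) M ` ?F) ?F}"
      unfolding disjnt_iff by blast
  next
    fix M assume "M \<in> {M \<in> ?G. \<not> disjnt ((`) M ` ?F) ?F}"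
    then obtain i j where "i < N" "j < N" "M \<in> ?G" "M ` V i = V j"
      unfolding disjnt_iff by blast
    then show "M \<in> ?D" using assms(13) by auto
  qed
  then have "card ?G \<le> max_partial_parallelism (extension_scale \<iota>) k * card ?D"
    using card_general_linear_le[OF vector_space_extension_scale[OF assms(7)] spread] N by auto
  then have "real (card ?G) \<le> real (max_partial_parallelism (extension_scale \<iota>) k) * real (card ?D)"
    by (metis of_nat_le_iff of_nat_mult)
  then show ?thesis
    \<comment> \<open>If \<open>card ?D = 0\<close>, the quotient is 0 by the convention for
      division by zero.\<close>
    by (cases "card ?D = 0") (simp_all add: divide_le_eq)
qed

end
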